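(* Let $N\ge 1$ and let $D\subset\mathbb{C}^N$ be a domain. Then $D$ is the domain of convergence of some power series $\sum_{J\in\mathbb{N}_0^N} c_J z^J$ (with complex coefficients $c_J$, centred at the origin) if and only if $D$ is a logarithmically convex complete Reinhardt (i.e. complete multi-circular) domain.
   Context: $\mathbb{N}_0=\{0,1,2,\dots\}$. For $J=(j_1,\dots,j_N)\in\mathbb{N}_0^N$ and $z\in\mathbb{C}^N$, $z^J=z_1^{j_1}\cdots z_N^{j_N}$. A domain is a nonempty connected open subset of $\mathbb{C}^N$. A series of complex numbers $\sum_J a_J$ indexed by $\mathbb{N}_0^N$ is called convergent if it is absolutely convergent, i.e. $\sum_J |a_J|<\infty$. For a power series $\sum_J c_J z^J$ let $B$ be the set of all $z\in\mathbb{C}^N$ at which the series converges in this sense; the interior $B^0$ of $B$ is the domain of convergence of the power series. A domain $D\subset\mathbb{C}^N$ is Reinhardt (multi-circular) if $z\in D$ implies $(e^{i\theta_1}z_1,\dots,e^{i\theta_N}z_N)\in D$ for all $\theta\in\mathbb{R}^N$. A Reinhardt domain is complete if $z\in D$ implies $(\lambda_1z_1,\dots,\lambda_Nz_N)\in D$ for all $\lambda_1,\dots,\lambda_N\in\mathbb{C}$ with $|\lambda_j|\le 1$. Let $\lambda:(\mathbb{C}\setminus\{0\})^N\to\mathbb{R}^N$, $\lambda(z)=(\log|z_1|,\dots,\log|z_N|)$. A Reinhardt domain $D$ is logarithmically convex if $\lambda\big(D\cap(\mathbb{C}\setminus\{0\})^N\big)$ is a convex subset of $\mathbb{R}^N$.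 *)

theory Defs
  imports "HOL-Analysis.Analysis"
begin

definition is_domain :: "(complex ^ 'n) set \<Rightarrow> bool" where
  "is_domain D \<longleftrightarrow> D \<noteq> {} \<and> open D \<and> connected D"

definition monomial :: "complex ^ 'n \<Rightarrow> nat ^ 'n \<Rightarrow> complex" where
  "monomial z J = (\<Prod>j\<in>UNIV. (z $ j) ^ (J $ j))"

definition convergence_set :: "(nat ^ 'n \<Rightarrow> complex) \<Rightarrow> (complex ^ 'n) set" where
  "convergence_set c = {z. (\<lambda>J. norm (c J * monomial z J)) summable_on UNIV}"

definition domain_of_convergence :: "(nat ^ 'n \<Rightarrow> complex) \<Rightarrow> (complex ^ 'n) set" where
  "domain_of_convergence c = interior (convergence_set c)"

definition reinhardt_domain :: "(complex ^ 'n) set \<Rightarrow> bool" where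
  "reinhardt_domain D \<longleftrightarrow> is_domain D \<and>
     (\<forall>z\<in>D. \<forall>\<theta> :: real ^ 'n. (\<chi> j. exp (\<i> * complex_of_real (\<theta> $ j)) * z $ j) \<in> D)"

definition complete_reinhardt_domain :: "(complex ^ 'n) set \<Rightarrow> bool" where
  "complete_reinhardt_domain D \<longleftrightarrow> reinhardt_domain D \<and>
     (\<forall>z\<in>D. \<forall>w :: complex ^ 'n. (\<forall>j. norm (w $ j) \<le> 1) \<longrightarrow> (\<chi> j. w $ j * z $ j) \<in> D)"

(* Only applied to points all of whose coordinates are nonzero (HOL sets ln 0 = 0). *)
definition log_map :: "complex ^ 'n \<Rightarrow> real ^ 'n" where
  "log_map z = (\<chi> j. ln (norm (z $ j)))"

definition logarithmically_convex :: "(complex ^ 'n) set \<Rightarrow> bool" where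
  "logarithmically_convex D \<longleftrightarrow> convex (log_map ` (D \<inter> {z. \<forall>j. z $ j \<noteq> 0}))"

end

theory Submission
  imports Defs
begin

text \<open>
  Abel's lemma gives the central description of the domain of convergence: \<^term>\<open>z\<close> belongs to it
  if and only if some \<^term>\<open>y\<close> with strictly larger coordinate moduli makes the terms of the series
  \<^emph>\<open>bounded\<close> (\<open>domain_of_convergence_iff\<close>). Boundedness depends only on the moduli of the coordinates,
  is inherited by smaller moduli, and passes from two points to all their weighted geometric means,
  because the logarithm of the modulus of a monomial is linear in the logarithms of the moduli. So
  every domain of convergence is complete, Reinhardt and logarithmically convex.

  Conversely, let \<open>D\<close> be complete and logarithmically convex. The natural candidate for the
  coefficient of \<open>z\<^sup>J\<close> is the reciprocal of the supremum of the modulus of \<open>z\<^sup>J\<close> over \<open>D\<close>, but this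
  supremum may be infinite. For the domain where the modulus of \<open>z\<^sub>1\<close> times an irrational power of the
  modulus of \<open>z\<^sub>2\<close> is less than \<open>1\<close>, it is infinite for every nonconstant monomial. The supremum is
  therefore taken over the part of \<open>D\<close> in a polydisc whose radius grows linearly in the degree of \<open>J\<close>
  (\<open>monomial_sup\<close>). A given point lies in all but finitely many of these polydiscs, so the terms stay
  bounded on \<open>D\<close> and the series converges there.

  If the series had bounded terms at some \<^term>\<open>y\<close> with larger moduli than a point \<open>z\<close> outside \<open>D\<close>, an
  intermediate point has a logarithmic image \<open>p\<close> outside the convex logarithmic image of \<open>D\<close>. A
  separating functional \<open>\<alpha>\<close> has nonnegative entries since \<open>D\<close> is complete. Along multi-indices \<open>J\<close>
  within distance \<open>1\<close> of the ray through \<open>\<alpha>\<close>, the modulus of \<open>z\<^sup>J\<close> at the intermediate point bounds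
  the modulus over the truncated \<open>D\<close> up to a factor polynomial in the degree: rounding costs a
  bounded multiple of the logarithm of the radius. Passing from the intermediate point to \<^term>\<open>y\<close>
  gains an exponential factor, so the terms at \<^term>\<open>y\<close> are unbounded, a contradiction
  (\<open>domain_of_convergence_monomial_sup_subset\<close>).
\<close>

section \<open>Monomials and the geometric series in several variables\<close>

definition mdegree :: "nat ^ 'n \<Rightarrow> nat" where
  "mdegree J = (\<Sum>j\<in>UNIV. J $ j)"

lemma norm_monomial: "norm (monomial z J) = (\<Prod>j\<in>UNIV. norm (z $ j) ^ (J $ j))"
  by (simp add: monomial_def norm_power flip: prod_norm)

lemma norm_monomial_le_scale:
  assumes "0 \<le> q" and "\<And>j. norm (z $ j) \<le> q * norm (y $ j)"
  shows "norm (monomial z J) \<le> q ^ mdegree J * norm (monomial y J)"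
proof -
  have "norm (monomial z J) \<le> (\<Prod>j\<in>UNIV. (q * norm (y $ j)) ^ (J $ j))"
    unfolding norm_monomial by (intro prod_mono conjI power_mono assms) auto
  also have "\<dots> = q ^ mdegree J * norm (monomial y J)"
    by (simp add: norm_monomial power_mult_distrib prod.distrib mdegree_def power_sum)
  finally show ?thesis .
qed

lemma norm_monomial_mono:
  assumes "\<And>j. norm (z $ j) \<le> norm (y $ j)"
  shows "norm (monomial z J) \<le> norm (monomial y J)"
  using norm_monomial_le_scale[of 1 z y J] assms by simp

lemma norm_monomial_exp:
  assumes "\<And>j. z $ j \<noteq> 0"
  shows "norm (monomial z J) = exp (\<Sum>j\<in>UNIV. real (J $ j) * ln (norm (z $ j)))"
  using assms by (simp add: norm_monomial exp_sum exp_of_nat_mult)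

lemma finite_box: "finite {J :: nat ^ 'n. \<forall>j. J $ j < m}"
proof -
  have "finite ((\<lambda>f. vec_lambda f :: nat ^ 'n) ` (PiE UNIV (\<lambda>_. {..<m})))"
    by (intro finite_imageI finite_PiE) auto
  moreover have "{J :: nat ^ 'n. \<forall>j. J $ j < m} \<subseteq> (\<lambda>f. vec_lambda f) ` (PiE UNIV (\<lambda>_. {..<m}))"
  proof
    fix J :: "nat ^ 'n" assume "J \<in> {J. \<forall>j. J $ j < m}"
    then show "J \<in> (\<lambda>f. vec_lambda f) ` (PiE UNIV (\<lambda>_. {..<m}))"
      by (intro image_eqI[of _ _ "vec_nth J"]) (auto simp: vec_lambda_eta)
  qed
  ultimately show ?thesis by (rule rev_finite_subset)
qed

lemma component_le_mdegree: "J $ j \<le> mdegree J"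
  unfolding mdegree_def by (rule member_le_sum) auto

text \<open>The sum over a box of multi-indices factors into one-dimensional geometric sums, and every
  finite set of multi-indices lies in a box.\<close>

lemma summable_on_geometric_mdegree:
  fixes q :: real
  assumes "0 \<le> q" "q < 1"
  shows "(\<lambda>J :: nat ^ 'n. q ^ mdegree J) summable_on UNIV"
proof (rule nonneg_bdd_above_summable_on)
  show "bdd_above (sum (\<lambda>J :: nat ^ 'n. q ^ mdegree J) ` {F. F \<subseteq> UNIV \<and> finite F})"
  proof (rule bdd_aboveI2)
    fix F :: "(nat ^ 'n) set" assume "F \<in> {F. F \<subseteq> UNIV \<and> finite F}"
    then have fin: "finite F" by simp
    define m where "m = Suc (\<Sum>J\<in>F. mdegree J)"
    have sub: "F \<subseteq> {J. \<forall>j. J $ j < m}"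
    proof safe
      fix J j assume "J \<in> F"
      then have "mdegree J \<le> (\<Sum>J\<in>F. mdegree J)" by (intro member_le_sum fin) auto
      then show "J $ j < m" using component_le_mdegree[of J j] by (simp add: m_def)
    qed
    have "(\<Sum>J\<in>F. q ^ mdegree J) \<le> (\<Sum>J | \<forall>j. (J :: nat ^ 'n) $ j < m. q ^ mdegree J)"
      using assms by (intro sum_mono2 finite_box sub) auto
    also have "\<dots> = (\<Sum>f\<in>PiE (UNIV :: 'n set) (\<lambda>_. {..<m}). \<Prod>j\<in>UNIV. q ^ f j)"
      by (rule sum.reindex_bij_witness[of _ "vec_lambda" "vec_nth"])
        (auto simp: mdegree_def power_sum vec_lambda_eta)
    also have "\<dots> = (\<Prod>j\<in>(UNIV :: 'n set). \<Sum>i<m. q ^ i)"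
      by (rule prod_sum_PiE[symmetric]) auto
    also have "\<dots> \<le> (\<Prod>j\<in>(UNIV :: 'n set). 1 / (1 - q))"
    proof (intro prod_mono conjI)
      show "(\<Sum>i<m. q ^ i) \<le> 1 / (1 - q)"
        using assms sum_le_suminf[of "\<lambda>i. q ^ i" "{..<m}"]
        by (simp add: suminf_geometric summable_geometric)
    qed (use assms in \<open>auto intro: sum_nonneg\<close>)
    finally show "(\<Sum>J\<in>F. q ^ mdegree J) \<le> (\<Prod>j\<in>(UNIV :: 'n set). 1 / (1 - q))" .
  qed
qed (use assms in auto)

section \<open>Abel's lemma and the shape of domains of convergence\<close>

text \<open>A single factor serves all coordinates because there are finitely many of them.\<close>

lemma ex_scale_between:
  fixes z y :: "complex ^ 'n"
  assumes "\<And>j. norm (z $ j) < norm (y $ j)"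
  obtains q where "0 < q" "q < 1" "\<And>j. norm (z $ j) < q * norm (y $ j)"
proof -
  have "\<forall>\<^sub>F q in at_left 1. \<forall>j\<in>UNIV. norm (z $ j) < q * norm (y $ j)"
  proof (intro eventually_ball_finite ballI)
    fix j
    have "((\<lambda>q. q * norm (y $ j)) \<longlongrightarrow> 1 * norm (y $ j)) (at_left 1)"
      by (intro tendsto_intros)
    then show "\<forall>\<^sub>F q in at_left 1. norm (z $ j) < q * norm (y $ j)"
      by (rule order_tendstoD) (use assms in simp)
  qed auto
  moreover have "\<forall>\<^sub>F q in at_left (1::real). q \<in> {0<..<1}"
    by (rule eventually_at_left_real) simp
  ultimately have "\<forall>\<^sub>F q in at_left (1::real). q \<in> {0<..<1} \<and> (\<forall>j. norm (z $ j) < q * norm (y $ j))"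
    by eventually_elim auto
  then show ?thesis
    using that eventually_happens'[OF trivial_limit_at_left_real] by force
qed

text \<open>Moving each coordinate radially outwards increases its modulus; at a zero coordinate every
  direction does.\<close>

lemma open_ex_larger:
  fixes z :: "complex ^ 'n"
  assumes "open D" "z \<in> D"
  obtains y where "y \<in> D" "\<And>j. norm (z $ j) < norm (y $ j)"
proof -
  define s :: "complex ^ 'n" where "s = (\<chi> j. if z $ j = 0 then 1 else sgn (z $ j))"
  obtain e where e: "e > 0" "ball z e \<subseteq> D"
    using assms open_contains_ball by blast
  define t where "t = e / (2 * (1 + norm s))"
  have t: "t > 0" using e by (simp add: t_def add_pos_nonneg)
  have "t * norm s < t * (2 * (1 + norm s))"
    by (intro mult_strict_left_mono t) (simp add: algebra_simps add_nonneg_pos)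
  also have "\<dots> = e"
    using norm_ge_zero[of s] by (simp add: t_def del: norm_ge_zero)
  finally have "t * norm s < e" .
  then have "z + t *\<^sub>R s \<in> D"
    using e t by (auto simp: dist_norm subset_iff)
  moreover have "norm (z $ j) < norm ((z + t *\<^sub>R s) $ j)" for j
  proof (cases "z $ j = 0")
    case False
    then have "(z + t *\<^sub>R s) $ j = (norm (z $ j) + t) *\<^sub>R sgn (z $ j)"
      by (simp add: s_def sgn_div_norm algebra_simps)
    then show ?thesis using t False by (simp add: norm_sgn)
  qed (use t in \<open>simp add: s_def\<close>)
  ultimately show ?thesis by (rule that)
qed

text \<open>Abel's lemma: bounded terms at \<open>y\<close> are dominated by a geometric series at every point with
  strictly smaller moduli, and those points form an open set. In the other direction, an interior
  point can be enlarged without leaving the convergence set, where the terms are bounded by the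
  sum of their moduli.\<close>

lemma domain_of_convergence_iff:
  fixes c :: "nat ^ 'n \<Rightarrow> complex"
  shows "z \<in> domain_of_convergence c \<longleftrightarrow>
    (\<exists>y K. (\<forall>j. norm (z $ j) < norm (y $ j)) \<and> (\<forall>J. norm (c J * monomial y J) \<le> K))"
    (is "_ \<longleftrightarrow> ?R z")
proof
  assume "z \<in> domain_of_convergence c"
  then obtain y where y: "y \<in> domain_of_convergence c" "\<And>j. norm (z $ j) < norm (y $ j)"
    unfolding domain_of_convergence_def by (metis open_ex_larger open_interior)
  then have "y \<in> convergence_set c"
    using interior_subset unfolding domain_of_convergence_def by blast
  then have sm: "(\<lambda>J. norm (c J * monomial y J)) summable_on UNIV"
    by (simp add: convergence_set_def)
  have "norm (c J * monomial y J) \<le> (\<Sum>\<^sub>\<infinity>J. norm (c J * monomial y J))" for J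
    using finite_sum_le_infsum[OF sm, of "{J}"] by simp
  with y show "?R z" by blast
next
  have "Collect ?R \<subseteq> convergence_set c"
  proof
    fix z assume "z \<in> Collect ?R"
    then obtain y K where y: "\<And>j. norm (z $ j) < norm (y $ j)"
      and K: "\<And>J. norm (c J * monomial y J) \<le> K" by auto
    obtain q where q: "0 < q" "q < 1" "\<And>j. norm (z $ j) < q * norm (y $ j)"
      using ex_scale_between[OF y] by blast
    have le: "norm (c J * monomial z J) \<le> K * q ^ mdegree J" for J
    proof -
      have "norm (c J * monomial z J) \<le> norm (c J) * (q ^ mdegree J * norm (monomial y J))"
        unfolding norm_mult
        using q by (intro mult_left_mono norm_monomial_le_scale) (simp_all add: less_imp_le)
      also have "\<dots> = norm (c J * monomial y J) * q ^ mdegree J"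
        by (simp add: norm_mult)
      also have "\<dots> \<le> K * q ^ mdegree J"
        using q K by (intro mult_right_mono) auto
      finally show ?thesis .
    qed
    have "(\<lambda>J :: nat ^ 'n. K * q ^ mdegree J) summable_on UNIV"
      using q by (intro summable_on_cmult_right summable_on_geometric_mdegree) auto
    then have "(\<lambda>J. norm (c J * monomial z J)) summable_on UNIV"
      by (rule summable_on_comparison_test) (use le in simp_all)
    then show "z \<in> convergence_set c" by (simp add: convergence_set_def)
  qed
  moreover have "open (Collect ?R)"
  proof -
    have "Collect ?R = (\<Union>y\<in>{y. \<exists>K. \<forall>J. norm (c J * monomial y J) \<le> K}.
        \<Inter>j. {z. norm (z $ j) < norm (y $ j)})"
      by blast
    moreover have "open {z :: complex ^ 'n. norm (z $ j) < r}" for j r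
      by (intro open_Collect_less continuous_intros)
    ultimately show ?thesis by (auto intro!: open_INT)
  qed
  ultimately have "Collect ?R \<subseteq> domain_of_convergence c"
    unfolding domain_of_convergence_def by (rule interior_maximal)
  then show "?R z \<Longrightarrow> z \<in> domain_of_convergence c" by blast
qed

text \<open>Rotations are multiplications by numbers of modulus \<open>1\<close>, so both closure conditions reduce to
  one on the moduli of the coordinates.\<close>

lemma complete_reinhardt_domain_iff_solid:
  fixes D :: "(complex ^ 'n) set"
  shows "complete_reinhardt_domain D \<longleftrightarrow>
    is_domain D \<and> (\<forall>y\<in>D. \<forall>z. (\<forall>j. norm (z $ j) \<le> norm (y $ j)) \<longrightarrow> z \<in> D)"
proof safe
  assume C: "complete_reinhardt_domain D"
  then show "is_domain D"
    by (simp add: complete_reinhardt_domain_def reinhardt_domain_def)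
  fix y z :: "complex ^ 'n" assume y: "y \<in> D" and le: "\<forall>j. norm (z $ j) \<le> norm (y $ j)"
  define w :: "complex ^ 'n" where "w = (\<chi> j. z $ j / y $ j)"
  have "\<forall>j. norm (w $ j) \<le> 1"
    using le by (auto simp: w_def norm_divide divide_le_eq_1)
  then have "(\<chi> j. w $ j * y $ j) \<in> D"
    using C y unfolding complete_reinhardt_domain_def by blast
  moreover have "(\<chi> j. w $ j * y $ j) = z"
    using le by (auto simp: w_def vec_eq_iff) (metis norm_le_zero_iff norm_zero)
  ultimately show "z \<in> D" by simp
next
  assume D: "is_domain D" and S: "\<forall>y\<in>D. \<forall>z. (\<forall>j. norm (z $ j) \<le> norm (y $ j)) \<longrightarrow> z \<in> D"
  show "complete_reinhardt_domain D"
    unfolding complete_reinhardt_domain_def reinhardt_domain_def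
  proof (intro conjI D ballI allI impI)
    fix y and \<theta> :: "real ^ 'n" assume "y \<in> D"
    with S show "(\<chi> j. exp (\<i> * complex_of_real (\<theta> $ j)) * y $ j) \<in> D"
      by (auto simp: norm_mult elim!: ballE)
  next
    fix y and w :: "complex ^ 'n" assume "y \<in> D" "\<forall>j. norm (w $ j) \<le> 1"
    with S show "(\<chi> j. w $ j * y $ j) \<in> D"
      by (auto simp: norm_mult mult_left_le_one_le elim!: ballE)
  qed
qed

text \<open>A convex combination of logarithmic images is the logarithmic image of a weighted geometric
  mean of the moduli. The bounds on the terms at two points pass to their geometric mean, and the
  mean is strictly monotone, so strict domination passes to it as well.\<close>

lemma logarithmically_convex_domain_of_convergence:
  fixes c :: "nat ^ 'n \<Rightarrow> complex"
  shows "logarithmically_convex (domain_of_convergence c)"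
  unfolding logarithmically_convex_def
proof (rule convexI)
  let ?L = "log_map ` (domain_of_convergence c \<inter> {z. \<forall>j. z $ j \<noteq> 0})"
  fix a b :: "real ^ 'n" and u v :: real
  assume "a \<in> ?L" "b \<in> ?L" and uv: "0 \<le> u" "0 \<le> v" "u + v = 1"
  then obtain x y where x: "x \<in> domain_of_convergence c" "\<And>j. x $ j \<noteq> 0" "a = log_map x"
    and y: "y \<in> domain_of_convergence c" "\<And>j. y $ j \<noteq> 0" "b = log_map y"
    by auto
  obtain x' K where x': "\<And>j. norm (x $ j) < norm (x' $ j)" "\<And>J. norm (c J * monomial x' J) \<le> K"
    using x by (auto simp: domain_of_convergence_iff)
  obtain y' L where y': "\<And>j. norm (y $ j) < norm (y' $ j)" "\<And>J. norm (c J * monomial y' J) \<le> L"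
    using y by (auto simp: domain_of_convergence_iff)
  have nz: "x' $ j \<noteq> 0" "y' $ j \<noteq> 0" for j
    using x'(1)[of j] y'(1)[of j] by auto
  \<comment> \<open>the coordinatewise weighted geometric mean of the moduli\<close>
  define g :: "complex ^ 'n \<Rightarrow> complex ^ 'n \<Rightarrow> complex ^ 'n"
    where "g = (\<lambda>x y. \<chi> j. complex_of_real (exp (u * ln (norm (x $ j)) + v * ln (norm (y $ j)))))"
  have g: "norm (g x y $ j) = exp (u * ln (norm (x $ j)) + v * ln (norm (y $ j)))" for x y j
    by (simp add: g_def)
  have g_nz: "g x y $ j \<noteq> 0" for x y j by (simp add: g_def)
  have lt: "norm (g x y $ j) < norm (g x' y' $ j)" for j
  proof -
    have 1: "ln (norm (x $ j)) < ln (norm (x' $ j))" "ln (norm (y $ j)) < ln (norm (y' $ j))"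
      using x' y' x y nz by auto
    have "u * ln (norm (x $ j)) + v * ln (norm (y $ j)) < u * ln (norm (x' $ j)) + v * ln (norm (y' $ j))"
    proof (cases "u = 0")
      case False
      then show ?thesis
        using 1 uv by (intro add_less_le_mono mult_strict_left_mono mult_left_mono) auto
    qed (use 1 uv in auto)
    then show ?thesis by (simp add: g)
  qed
  have bd: "norm (c J * monomial (g x' y') J) \<le> max K L" for J
  proof -
    define A where "A = (\<Sum>j\<in>UNIV. real (J $ j) * ln (norm (x' $ j)))"
    define B where "B = (\<Sum>j\<in>UNIV. real (J $ j) * ln (norm (y' $ j)))"
    have "norm (monomial (g x' y') J) = exp (u * A + v * B)"
      by (simp add: norm_monomial_exp g_nz g A_def B_def sum_distrib_left sum.distrib algebra_simps)
    also have "u * A + v * B \<le> max A B"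
      by (rule convex_bound_le) (use uv in auto)
    also have "exp (max A B) = max (norm (monomial x' J)) (norm (monomial y' J))"
      by (simp add: norm_monomial_exp nz A_def B_def max_def)
    finally have "norm (c J * monomial (g x' y') J) \<le>
        norm (c J) * max (norm (monomial x' J)) (norm (monomial y' J))"
      by (simp add: norm_mult mult_left_mono)
    also have "\<dots> = max (norm (c J * monomial x' J)) (norm (c J * monomial y' J))"
      by (simp add: norm_mult max_mult_distrib_left)
    also have "\<dots> \<le> max K L" using x' y' by (intro max.mono) auto
    finally show ?thesis .
  qed
  have "g x y \<in> domain_of_convergence c"
    using lt bd by (auto simp: domain_of_convergence_iff)
  moreover have "u *\<^sub>R a + v *\<^sub>R b = log_map (g x y)"
    unfolding x y by (simp add: log_map_def vec_eq_iff g)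
  ultimately show "u *\<^sub>R a + v *\<^sub>R b \<in> ?L"
    using g_nz by blast
qed

section \<open>A power series adapted to a complete Reinhardt domain\<close>

text \<open>Points with a zero coordinate are left out so that logarithms apply; completeness and
  openness recover them. The radius tends to infinity, so that every point with nonzero
  coordinates is eventually included, and it does so subexponentially in the degree, so that
  rounding exponents to integers changes the suprema only by subexponential factors.\<close>

definition bounded_torus_part :: "(complex ^ 'n) set \<Rightarrow> nat \<Rightarrow> (complex ^ 'n) set" where
  "bounded_torus_part D m = {w \<in> D. \<forall>j. w $ j \<noteq> 0 \<and> norm (w $ j) \<le> real m + 1}"

definition monomial_sup :: "(complex ^ 'n) set \<Rightarrow> nat ^ 'n \<Rightarrow> real" where
  "monomial_sup D J = (SUP w\<in>bounded_torus_part D (mdegree J). norm (monomial w J))"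

lemma complete_reinhardt_domainD:
  fixes D :: "(complex ^ 'n) set"
  assumes "complete_reinhardt_domain D" "y \<in> D" "\<And>j. norm (z $ j) \<le> norm (y $ j)"
  shows "z \<in> D"
  using assms complete_reinhardt_domain_iff_solid by blast

lemma bounded_torus_part_nonempty:
  assumes "complete_reinhardt_domain D"
  shows "bounded_torus_part D m \<noteq> {}"
proof -
  have D: "open D" "D \<noteq> {}"
    using assms by (auto simp: complete_reinhardt_domain_iff_solid is_domain_def)
  then obtain x where "x \<in> D" by blast
  obtain y where "y \<in> D" and y: "\<And>j. norm (x $ j) < norm (y $ j)"
    using open_ex_larger[OF D(1) \<open>x \<in> D\<close>] by metis
  define w where "w = (\<chi> j. complex_of_real (min 1 (norm (y $ j))))"
  have "norm (y $ j) > 0" for j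
    using y[of j] norm_ge_zero[of "x $ j"] by linarith
  then have "w \<in> bounded_torus_part D m"
    unfolding bounded_torus_part_def using complete_reinhardt_domainD[OF assms \<open>y \<in> D\<close>, of w]
    by (auto simp: w_def min_def)
  then show ?thesis by blast
qed

lemma monomial_le_monomial_sup:
  assumes "w \<in> bounded_torus_part D (mdegree J)"
  shows "norm (monomial w J) \<le> monomial_sup D J"
  unfolding monomial_sup_def
proof (rule cSUP_upper[OF assms])
  let ?R = "complex_of_real (real (mdegree J) + 1)"
  show "bdd_above ((\<lambda>w. norm (monomial w J)) ` bounded_torus_part D (mdegree J))"
  proof (rule bdd_aboveI2[OF norm_monomial_mono])
    fix w j assume "w \<in> bounded_torus_part D (mdegree J)"
    moreover have "norm ?R = real (mdegree J) + 1" by (subst norm_of_real) simp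
    ultimately show "norm (w $ j) \<le> norm ((\<chi> j. ?R) $ j)"
      by (simp only: bounded_torus_part_def mem_Collect_eq vec_lambda_beta)
  qed
qed

lemma monomial_sup_pos:
  assumes "complete_reinhardt_domain D"
  shows "monomial_sup D J > 0"
proof -
  obtain w where w: "w \<in> bounded_torus_part D (mdegree J)"
    using bounded_torus_part_nonempty[OF assms] by blast
  then have "0 < norm (monomial w J)"
    by (subst norm_monomial_exp) (auto simp: bounded_torus_part_def)
  also have "\<dots> \<le> monomial_sup D J" by (rule monomial_le_monomial_sup[OF w])
  finally show ?thesis .
qed

text \<open>The coefficients make a term at most \<open>1\<close> as soon as the polydisc belonging to its degree
  contains the point; only finitely many multi-indices have smaller degree.\<close>

lemma subset_domain_of_convergence_monomial_sup:
  fixes D :: "(complex ^ 'n) set"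
  assumes D: "complete_reinhardt_domain D"
  shows "D \<subseteq> domain_of_convergence (\<lambda>J. of_real (1 / monomial_sup D J))"
proof
  let ?c = "\<lambda>J :: nat ^ 'n. complex_of_real (1 / monomial_sup D J)"
  fix z assume "z \<in> D"
  moreover have "open D"
    using D by (simp add: complete_reinhardt_domain_iff_solid is_domain_def)
  ultimately obtain y where y: "y \<in> D" "\<And>j. norm (z $ j) < norm (y $ j)"
    using open_ex_larger by metis
  define E where "E = {J :: nat ^ 'n. \<forall>j. J $ j < nat \<lceil>norm y\<rceil>}"
  have fin: "finite E" unfolding E_def by (rule finite_box)
  have "norm (?c J * monomial y J) \<le> 1 + (\<Sum>J\<in>E. norm (?c J * monomial y J))" for J
  proof (cases "J \<in> E")
    case True
    then show ?thesis
      using member_le_sum[OF True _ fin, of "\<lambda>J. norm (?c J * monomial y J)"] by simp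
  next
    case False
    then obtain j where "norm y \<le> real (J $ j)"
      by (auto simp: E_def not_less nat_le_iff ceiling_le_iff)
    then have "norm y \<le> real (mdegree J)"
      using component_le_mdegree[of J j] by linarith
    then have "norm (y $ i) \<le> real (mdegree J) + 1" for i
      using Finite_Cartesian_Product.norm_nth_le[of y i] by linarith
    moreover have "y $ i \<noteq> 0" for i
      using y(2)[of i] by auto
    ultimately have "norm (monomial y J) \<le> monomial_sup D J"
      using y(1) by (intro monomial_le_monomial_sup) (auto simp: bounded_torus_part_def)
    then have "norm (?c J * monomial y J) \<le> 1"
      using monomial_sup_pos[OF D, of J] by (simp add: norm_mult norm_divide)
    also have "\<dots> \<le> 1 + (\<Sum>J\<in>E. norm (?c J * monomial y J))"
      by (simp add: sum_nonneg)
    finally show ?thesis .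
  qed
  with y show "z \<in> domain_of_convergence ?c"
    unfolding domain_of_convergence_iff by blast
qed

section \<open>Separation and divergence outside the domain\<close>

text \<open>The logarithmic image of a complete domain is closed under decreasing coordinates, so a
  functional bounded above on it cannot have a negative entry. Nonnegativity is what allows
  \<open>\<alpha>\<close> to be approximated by exponents of monomials.\<close>

lemma ex_nonneg_supporting_functional:
  fixes D :: "(complex ^ 'n) set"
  defines "L \<equiv> log_map ` (D \<inter> {z. \<forall>j. z $ j \<noteq> 0})"
  assumes D: "complete_reinhardt_domain D" "logarithmically_convex D" and p: "p \<notin> L"
  obtains \<alpha> :: "real ^ 'n" where "\<alpha> \<noteq> 0" "\<And>j. 0 \<le> \<alpha> $ j" "\<And>x. x \<in> L \<Longrightarrow> \<alpha> \<bullet> x \<le> \<alpha> \<bullet> p"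
proof -
  have "convex L" using D(2) by (simp add: logarithmically_convex_def L_def)
  moreover obtain w0 where w0: "w0 \<in> D" "\<And>j. w0 $ j \<noteq> 0"
    using bounded_torus_part_nonempty[OF D(1), of 0] by (auto simp: bounded_torus_part_def)
  then have L0: "log_map w0 \<in> L" by (auto simp: L_def)
  ultimately obtain \<alpha> b where \<alpha>: "\<alpha> \<noteq> 0" "\<And>x. x \<in> L \<Longrightarrow> \<alpha> \<bullet> x \<le> b" "b \<le> \<alpha> \<bullet> p"
    using separating_hyperplane_sets[of L "{p}"] p by auto
  have "0 \<le> \<alpha> $ j" for j
  proof (rule ccontr)
    assume "\<not> 0 \<le> \<alpha> $ j"
    then have neg: "\<alpha> $ j < 0" by simp
    \<comment> \<open>the step in direction \<open>- axis j 1\<close> that raises the functional to \<open>b + 1\<close>\<close>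
    define t where "t = (b - \<alpha> \<bullet> log_map w0 + 1) / (- \<alpha> $ j)"
    have "0 \<le> b - \<alpha> \<bullet> log_map w0" using \<alpha>(2)[OF L0] by simp
    then have t: "t > 0" using neg unfolding t_def by (intro divide_pos_pos) auto
    define w where "w = (\<chi> i. w0 $ i * of_real (if i = j then exp (- t) else 1))"
    have "norm (w $ i) \<le> norm (w0 $ i)" for i
      using t by (auto simp: w_def norm_mult intro!: mult_right_le_one_le)
    then have "w \<in> D" using complete_reinhardt_domainD[OF D(1) w0(1)] by blast
    moreover have "w $ i \<noteq> 0" for i using w0 by (simp add: w_def)
    ultimately have "log_map w \<in> L" by (auto simp: L_def)
    moreover have "log_map w = log_map w0 - t *\<^sub>R axis j 1"
      using w0 by (auto simp: log_map_def w_def vec_eq_iff axis_def norm_mult ln_mult)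
    ultimately have "\<alpha> \<bullet> (log_map w0 - t *\<^sub>R axis j 1) \<le> b" using \<alpha>(2) by simp
    then have "\<alpha> \<bullet> log_map w0 - t * \<alpha> $ j \<le> b"
      by (simp add: inner_diff_right inner_axis)
    moreover have "t * \<alpha> $ j = - (b - \<alpha> \<bullet> log_map w0 + 1)"
      using neg by (simp add: t_def)
    ultimately show False by simp
  qed
  with \<alpha> show ?thesis by (intro that[of \<alpha>]) force+
qed

text \<open>Rounding is upwards because the points of the logarithmic image have coordinates bounded above
  by the logarithm of the radius but not bounded below: the rounding error must be nonnegative.\<close>

lemma ex_multiindex_near_ray:
  fixes \<alpha> :: "real ^ 'n"
  assumes "\<alpha> \<noteq> 0" "\<And>j. 0 \<le> \<alpha> $ j"
  obtains J :: "nat ^ 'n" and t :: real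
  where "m \<le> mdegree J" "0 \<le> t" "\<And>j. t * \<alpha> $ j \<le> real (J $ j)" "\<And>j. real (J $ j) \<le> t * \<alpha> $ j + 1"
proof -
  obtain i where "\<alpha> $ i \<noteq> 0" using assms(1) by (auto simp: vec_eq_iff)
  with assms(2)[of i] have i: "\<alpha> $ i > 0" by simp
  define t where "t = real m / \<alpha> $ i"
  define J :: "nat ^ 'n" where "J = (\<chi> j. nat \<lceil>t * \<alpha> $ j\<rceil>)"
  have t: "0 \<le> t" using i by (simp add: t_def)
  have "0 \<le> t * \<alpha> $ j" for j using t assms(2) by simp
  then have J: "real (J $ j) = of_int \<lceil>t * \<alpha> $ j\<rceil>" for j
    by (simp add: J_def)
  have "m = J $ i" using i by (simp add: J_def t_def)
  then have "m \<le> mdegree J" using component_le_mdegree by metis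
  then show ?thesis
    by (rule that[OF _ t]) (unfold J, linarith+)
qed

lemma ex_linear_dominates_ln:
  fixes \<delta> B C :: real
  assumes "\<delta> > 0" "B \<ge> 0"
  obtains m0 :: nat where "\<And>m. m0 \<le> m \<Longrightarrow> C < \<delta> * real m - B * ln (real m + 1)"
proof -
  define e where "e = \<delta> / (2 * (B + 1))"
  have e: "e > 0" "B * e \<le> \<delta> / 2" using assms by (auto simp: e_def field_simps)
  have "(\<lambda>m. ln (real (Suc m)) / real (Suc m)) \<longlonglongrightarrow> 0"
    using lim_ln_over_n LIMSEQ_Suc[of "\<lambda>n. ln (real n) / real n" 0] by simp
  then have "\<forall>\<^sub>F m in sequentially. ln (real (Suc m)) / real (Suc m) < e"
    using e(1) by (rule order_tendstoD(2))
  moreover have "\<forall>\<^sub>F m in sequentially. real m > (C + \<delta> / 2) / (\<delta> / 2)"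
    using filterlim_real_sequentially filterlim_at_top_dense by blast
  ultimately have "\<forall>\<^sub>F m in sequentially. C < \<delta> * real m - B * ln (real m + 1)"
  proof eventually_elim
    case (elim m)
    have "ln (real m + 1) \<le> e * (real m + 1)"
      using elim(1) by (simp add: divide_less_eq add.commute)
    then have "B * ln (real m + 1) \<le> B * (e * (real m + 1))"
      using assms(2) by (rule mult_left_mono)
    also have "\<dots> = B * e * (real m + 1)" by simp
    also have "\<dots> \<le> \<delta> / 2 * (real m + 1)" using e by (intro mult_right_mono) auto
    finally have "B * ln (real m + 1) \<le> \<delta> / 2 * real m + \<delta> / 2" by (simp add: algebra_simps)
    moreover have "C + \<delta> / 2 < \<delta> / 2 * real m"
      using elim(2) assms(1) by (simp add: divide_less_eq mult.commute)
    ultimately show ?case by linarith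
  qed
  then show ?thesis using that by (auto simp: eventually_sequentially)
qed

text \<open>With \<open>m\<close> the degree of \<open>J\<close>, the supporting functional bounds the supremum in the coefficient by
  \<open>exp M\<close>, where \<open>M\<close> exceeds the logarithm \<open>Jp\<close> of the monomial at the point with logarithmic
  image \<open>p\<close> only by \<open>O(ln m)\<close>. The point \<open>y\<close> is larger by the factor \<open>1 / q\<close> in each coordinate, which adds
  \<open>\<delta> m\<close> with \<open>\<delta> = - ln q > 0\<close> to the logarithm and wins for large \<open>m\<close>.\<close>

lemma domain_of_convergence_monomial_sup_subset:
  fixes D :: "(complex ^ 'n) set"
  assumes D: "complete_reinhardt_domain D" "logarithmically_convex D"
  shows "domain_of_convergence (\<lambda>J. of_real (1 / monomial_sup D J)) \<subseteq> D"
proof (rule subsetI, rule ccontr)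
  let ?c = "\<lambda>J. complex_of_real (1 / monomial_sup D J)"
  fix z assume "z \<in> domain_of_convergence ?c" and "z \<notin> D"
  then obtain y K where y: "\<And>j. norm (z $ j) < norm (y $ j)"
    and K: "\<And>J. norm (?c J * monomial y J) \<le> K"
    by (auto simp: domain_of_convergence_iff)
  obtain q where q: "0 < q" "q < 1" "\<And>j. norm (z $ j) < q * norm (y $ j)"
    using ex_scale_between[OF y] by blast
  have y_pos: "0 < norm (y $ j)" for j
    using y[of j] norm_ge_zero[of "z $ j"] by linarith
  define p where "p = (\<chi> j. ln (q * norm (y $ j)))"
  have "p \<notin> log_map ` (D \<inter> {z. \<forall>j. z $ j \<noteq> 0})"
  proof
    assume "p \<in> log_map ` (D \<inter> {z. \<forall>j. z $ j \<noteq> 0})"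
    then obtain w where w: "w \<in> D" "\<And>j. w $ j \<noteq> 0" "p = log_map w" by auto
    have "norm (w $ j) = q * norm (y $ j)" for j
    proof -
      have "ln (q * norm (y $ j)) = ln (norm (w $ j))"
        using w(3) by (simp add: p_def log_map_def vec_eq_iff)
      then show ?thesis using w(2) y_pos q(1) by (subst (asm) ln_inj_iff) auto
    qed
    then have "z \<in> D"
      using complete_reinhardt_domainD[OF D(1) w(1)] q(3) by (metis less_imp_le)
    with \<open>z \<notin> D\<close> show False ..
  qed
  then obtain \<alpha> where \<alpha>: "\<alpha> \<noteq> 0" "\<And>j. 0 \<le> \<alpha> $ j"
    and "\<And>x. x \<in> log_map ` (D \<inter> {z. \<forall>j. z $ j \<noteq> 0}) \<Longrightarrow> \<alpha> \<bullet> x \<le> \<alpha> \<bullet> p"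
    using ex_nonneg_supporting_functional[OF D] by blast
  then have sup: "\<alpha> \<bullet> log_map w \<le> \<alpha> \<bullet> p" if "w \<in> D" "\<And>j. w $ j \<noteq> 0" for w
    using that by blast
  define P where "P = (\<Sum>j\<in>UNIV. \<bar>p $ j\<bar>)"
  define \<delta> where "\<delta> = - ln q"
  define n where "n = real CARD('n)"
  have "\<delta> > 0" using q by (simp add: \<delta>_def)
  then obtain m0 where m0: "\<And>m. m0 \<le> m \<Longrightarrow> P + ln (\<bar>K\<bar> + 1) < \<delta> * real m - n * ln (real m + 1)"
    by (rule ex_linear_dominates_ln[of \<delta> n "P + ln (\<bar>K\<bar> + 1)"]) (auto simp: n_def)
  obtain J t where J: "m0 \<le> mdegree J" "0 \<le> t"
      "\<And>j. t * \<alpha> $ j \<le> real (J $ j)" "\<And>j. real (J $ j) \<le> t * \<alpha> $ j + 1"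
    using ex_multiindex_near_ray[OF \<alpha>] by metis
  define m where "m = mdegree J"
  define Jp where "Jp = (\<Sum>j\<in>UNIV. real (J $ j) * p $ j)"
  define M where "M = Jp + P + n * ln (real m + 1)"
  have "monomial_sup D J \<le> exp M"
    unfolding monomial_sup_def
  proof (rule cSUP_least[OF bounded_torus_part_nonempty[OF D(1)]])
    fix w assume "w \<in> bounded_torus_part D (mdegree J)"
    then have w: "w \<in> D" "\<And>j. w $ j \<noteq> 0" "\<And>j. norm (w $ j) \<le> real m + 1"
      by (auto simp: bounded_torus_part_def m_def)
    define x where "x = log_map w"
    have "real (J $ j) * x $ j \<le> t * (\<alpha> $ j * x $ j) + ln (real m + 1)" for j
    proof -
      have "x $ j \<le> ln (real m + 1)"
        using w by (simp add: x_def log_map_def)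
      then have "(real (J $ j) - t * \<alpha> $ j) * x $ j \<le> (real (J $ j) - t * \<alpha> $ j) * ln (real m + 1)"
        using J(3)[of j] by (intro mult_left_mono) auto
      also have "\<dots> \<le> 1 * ln (real m + 1)"
        using J(4)[of j] by (intro mult_right_mono) auto
      finally show ?thesis by (simp add: algebra_simps)
    qed
    then have "(\<Sum>j\<in>UNIV. real (J $ j) * x $ j) \<le> (\<Sum>j\<in>UNIV. t * (\<alpha> $ j * x $ j) + ln (real m + 1))"
      by (rule sum_mono)
    also have "\<dots> = t * (\<alpha> \<bullet> x) + n * ln (real m + 1)"
      by (simp add: sum.distrib inner_vec_def n_def sum_distrib_left)
    also have "t * (\<alpha> \<bullet> x) \<le> t * (\<alpha> \<bullet> p)"
      using J(2) sup w by (intro mult_left_mono) (auto simp: x_def)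
    also have "t * (\<alpha> \<bullet> p) = (\<Sum>j\<in>UNIV. t * \<alpha> $ j * p $ j)"
      by (simp add: inner_vec_def sum_distrib_left mult.assoc)
    also have "\<dots> \<le> (\<Sum>j\<in>UNIV. real (J $ j) * p $ j + \<bar>p $ j\<bar>)"
    proof (rule sum_mono)
      fix j
      have "(t * \<alpha> $ j - real (J $ j)) * p $ j \<le> \<bar>t * \<alpha> $ j - real (J $ j)\<bar> * \<bar>p $ j\<bar>"
        by (metis abs_ge_self abs_mult)
      also have "\<dots> \<le> 1 * \<bar>p $ j\<bar>"
        using J(3,4)[of j] by (intro mult_right_mono) auto
      finally show "t * \<alpha> $ j * p $ j \<le> real (J $ j) * p $ j + \<bar>p $ j\<bar>"
        by (simp add: algebra_simps)
    qed
    also have "\<dots> = Jp + P" by (simp add: sum.distrib Jp_def P_def)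
    finally have "(\<Sum>j\<in>UNIV. real (J $ j) * x $ j) \<le> M" by (simp add: M_def)
    then show "norm (monomial w J) \<le> exp M"
      using w(2) by (simp add: norm_monomial_exp x_def log_map_def)
  qed
  moreover have "norm (monomial y J) = exp (Jp + \<delta> * real m)"
  proof -
    have "ln (norm (y $ j)) = p $ j + \<delta>" for j
      using q y_pos[of j] by (simp add: p_def \<delta>_def ln_mult)
    then have "(\<Sum>j\<in>UNIV. real (J $ j) * ln (norm (y $ j))) = Jp + \<delta> * real m"
      by (simp add: Jp_def m_def mdegree_def algebra_simps sum.distrib sum_distrib_left)
    moreover have "y $ j \<noteq> 0" for j using y_pos[of j] by auto
    ultimately show ?thesis by (simp add: norm_monomial_exp)
  qed
  moreover have "norm (monomial y J) \<le> K * monomial_sup D J"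
    using K[of J] monomial_sup_pos[OF D(1), of J] by (simp add: norm_mult norm_divide divide_le_eq)
  moreover have "K * monomial_sup D J \<le> \<bar>K\<bar> * monomial_sup D J"
    using monomial_sup_pos[OF D(1), of J] by (intro mult_right_mono) auto
  moreover have "\<bar>K\<bar> * monomial_sup D J \<le> (\<bar>K\<bar> + 1) * monomial_sup D J"
    using monomial_sup_pos[OF D(1), of J] by (intro mult_right_mono) auto
  ultimately have "exp (Jp + \<delta> * real m) \<le> (\<bar>K\<bar> + 1) * exp M"
    by (smt (verit) mult_left_mono)
  also have "\<dots> = exp (ln (\<bar>K\<bar> + 1) + M)"
    by (simp add: exp_add add_nonneg_pos)
  finally have "Jp + \<delta> * real m \<le> ln (\<bar>K\<bar> + 1) + M" by simp
  with m0[OF J(1)] show False by (simp add: M_def m_def)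
qed

theorem mainTheorem1:
  fixes D :: "(complex ^ 'n) set"
  assumes "is_domain D"
  shows "(\<exists>c :: nat ^ 'n \<Rightarrow> complex. D = domain_of_convergence c) \<longleftrightarrow>
         complete_reinhardt_domain D \<and> logarithmically_convex D"
proof
  assume "\<exists>c :: nat ^ 'n \<Rightarrow> complex. D = domain_of_convergence c"
  then obtain c :: "nat ^ 'n \<Rightarrow> complex" where c: "D = domain_of_convergence c" ..
  have "z \<in> D" if "y \<in> D" "\<And>j. norm (z $ j) \<le> norm (y $ j)" for y z
    using that unfolding c domain_of_convergence_iff by (meson order.strict_trans1)
  then have "complete_reinhardt_domain D"
    using assms unfolding complete_reinhardt_domain_iff_solid by blast
  then show "complete_reinhardt_domain D \<and> logarithmically_convex D"
    by (simp add: c logarithmically_convex_domain_of_convergence)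
next
  assume "complete_reinhardt_domain D \<and> logarithmically_convex D"
  then have "D = domain_of_convergence (\<lambda>J. of_real (1 / monomial_sup D J))" 
    (is "_ = domain_of_convergence ?c")
    by (intro equalityI subset_domain_of_convergence_monomial_sup domain_of_convergence_monomial_sup_subset) auto
  then show "\<exists>c :: nat ^ 'n \<Rightarrow> complex. D = domain_of_convergence c"
    by (rule exI[of _ ?c])
qed

end
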